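(* Let $r$ be a positive integer and let ${\rm Li}_r(z)=\sum_{k=0}^{\infty}\frac{z^{k+1}}{(k+1)^r}\in\mathbb{Q}[[z]]$ be the $r$-th polylogarithm. Then ${\rm Li}_r(1/z)\in (1/z)\cdot\mathbb{Q}[[1/z]]$ is perfect, that is, every non-negative integer $n$ is normal with respect to ${\rm Li}_r(1/z)$.
   Context: For a formal Laurent series $g\in\mathbb{Q}((1/z))$, $g=\sum_k a_kz^{-k}$, put ${\rm ord}_\infty g=\min\{k\mid a_k\ne0\}$ (and $\infty$ if $g=0$). Let $f\in(1/z)\cdot\mathbb{Q}[[1/z]]$ and let $n$ be a non-negative integer. A pair $(P,Q)\in\mathbb{Q}[z]^2$ is a weight $n$ Padé approximant of $f$ if $P\ne0$, $\deg P\le n$ and ${\rm ord}_\infty(P(z)f(z)-Q(z))\ge n+1$. The integer $n$ is called normal with respect to $f$ if for every weight $n$ Padé approximant $(P,Q)$ of $f$ one has ${\rm ord}_\infty(P(z)f(z)-Q(z))=n+1$. *)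

theory Defs
  imports
    "HOL-Computational_Algebra.Formal_Laurent_Series"
    "HOL-Library.Extended"
begin

text \<open>
  \<open>\<rat>((1/z))\<close> is the type \<open>rat fls\<close>, whose variable \<open>fls_X\<close> plays the role of \<open>1/z\<close>:
  the coefficient \<open>a\<^sub>k\<close> of \<open>z\<^sup>-\<^sup>k\<close> in \<open>g\<close> is \<open>fls_nth g k\<close>, and \<open>z\<close> is \<open>fls_X_inv\<close>.
\<close>

definition ord_inf :: "rat fls \<Rightarrow> int extended" where
  "ord_inf g = (if g = 0 then Pinf else Fin (fls_subdegree g))"

definition poly_in_z :: "rat poly \<Rightarrow> rat fls" where
  "poly_in_z P = poly (map_poly fls_const P) fls_X_inv"

definition inv_z_power_series :: "rat fls set" where
  "inv_z_power_series = range (\<lambda>h :: rat fps. fls_X * fps_to_fls h)"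

definition pade_approximant :: "rat fls \<Rightarrow> nat \<Rightarrow> rat poly \<Rightarrow> rat poly \<Rightarrow> bool" where
  "pade_approximant f n P Q \<longleftrightarrow>
     P \<noteq> 0 \<and> degree P \<le> n \<and>
     ord_inf (poly_in_z P * f - poly_in_z Q) \<ge> Fin (int n + 1)"

definition normal_index :: "rat fls \<Rightarrow> nat \<Rightarrow> bool" where
  "normal_index f n \<longleftrightarrow>
     (\<forall>P Q. pade_approximant f n P Q \<longrightarrow>
        ord_inf (poly_in_z P * f - poly_in_z Q) = Fin (int n + 1))"

definition perfect :: "rat fls \<Rightarrow> bool" where
  "perfect f \<longleftrightarrow> (\<forall>n. normal_index f n)"

definition Li :: "nat \<Rightarrow> rat fps" where
  "Li r = Abs_fps (\<lambda>m. if m = 0 then 0 else 1 / of_nat m ^ r)"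

text \<open>
  \<open>Li\<^sub>r(1/z)\<close>: as \<open>fls_X\<close> stands for \<open>1/z\<close>, the substitution is the inclusion of power series
  into Laurent series.
\<close>

definition Li_inv_z :: "nat \<Rightarrow> rat fls" where
  "Li_inv_z r = fps_to_fls (Li r)"

end

(*
  Cancellation of the coefficients of z^-1, ..., z^-(n+1) in P Li_r(1/z) says that the coefficient
  vector c of P lies in the kernel of the Hankel matrix (1/(i+j+1)^r) with 0 <= i, j <= n.  This
  matrix is positive definite: writing H_r(c) for its quadratic form, 1/(i+j+1) is the integral of
  s^(i+j) over [0,1], so H_(r+1)(c) is the integral of H_r(c_0, c_1 s, ..., c_n s^n), and
  H_0(c) = (c_0 + ... + c_n)^2.
*)
theory Submission
  imports Defs Complex_Main
begin

definition hankel_form :: "nat \<Rightarrow> nat \<Rightarrow> (nat \<Rightarrow> real) \<Rightarrow> real" where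
  "hankel_form r n c = (\<Sum>i\<le>n. \<Sum>j\<le>n. c i * c j / of_nat (i + j + 1) ^ r)"

text \<open>The integral over [0, s] of H_r(c_0, c_1 t, ..., c_n t^n) dt in closed form, so that
  derivatives alone suffice.\<close>

definition hankel_primitive :: "nat \<Rightarrow> nat \<Rightarrow> (nat \<Rightarrow> real) \<Rightarrow> real \<Rightarrow> real" where
  "hankel_primitive r n c s =
     (\<Sum>i\<le>n. \<Sum>j\<le>n. c i * c j * s ^ (i + j + 1) / of_nat (i + j + 1) ^ Suc r)"

lemma hankel_form_0: "hankel_form 0 n c = (\<Sum>i\<le>n. c i)\<^sup>2"
  by (simp add: hankel_form_def power2_eq_square sum_product)

lemma hankel_primitive_0: "hankel_primitive r n c 0 = 0"
  by (simp add: hankel_primitive_def)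

lemma hankel_primitive_1: "hankel_primitive r n c 1 = hankel_form (Suc r) n c"
  by (simp add: hankel_primitive_def hankel_form_def)

lemma DERIV_hankel_primitive:
  "(hankel_primitive r n c has_real_derivative hankel_form r n (\<lambda>i. c i * s ^ i)) (at s)"
proof -
  have "((\<lambda>s. c i * c j * s ^ (i + j + 1) / of_nat (i + j + 1) ^ Suc r)
           has_real_derivative (c i * s ^ i) * (c j * s ^ j) / of_nat (i + j + 1) ^ r) (at s)" for i j
  proof (rule DERIV_cong)
    show "((\<lambda>s. c i * c j * s ^ (i + j + 1) / of_nat (i + j + 1) ^ Suc r) has_real_derivative
            c i * c j * (of_nat (i + j + 1) * s ^ (i + j)) / of_nat (i + j + 1) ^ Suc r) (at s)"
      using DERIV_pow[of "i + j + 1" s UNIV] by (intro DERIV_cdivide DERIV_cmult) simp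
    have "real (i + j + 1) \<noteq> 0" by simp
    then show "c i * c j * (of_nat (i + j + 1) * s ^ (i + j)) / of_nat (i + j + 1) ^ Suc r
        = (c i * s ^ i) * (c j * s ^ j) / of_nat (i + j + 1) ^ r"
      \<comment> \<open>Keeping \<open>of_nat (i + j + 1)\<close> unexpanded lets one nonzero factor
        cancel.\<close>
      by (simp only: power_Suc power_add) (simp del: of_nat_Suc of_nat_add)
  qed
  then show ?thesis
    unfolding hankel_primitive_def [abs_def] hankel_form_def by (intro DERIV_sum)
qed

text \<open>The primitive has a nonnegative derivative by the induction hypothesis for the scaled
  vector, whence the generalisation over \<open>c\<close>. It therefore increases from 0 at 0 to
  H_(r+1)(c) at 1.\<close>

lemma hankel_form_nonneg: "hankel_form r n c \<ge> 0"
proof (induction r arbitrary: c)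
  case 0
  show ?case by (simp add: hankel_form_0)
next
  case (Suc r)
  have "hankel_primitive r n c 0 \<le> hankel_primitive r n c 1"
    by (rule DERIV_nonneg_imp_nondecreasing[of 0 1 "hankel_primitive r n c"])
      (simp, rule exI, rule conjI[OF DERIV_hankel_primitive Suc])
  then show ?case by (simp add: hankel_primitive_0 hankel_primitive_1)
qed

text \<open>A nondecreasing primitive that is 0 at both ends of [0,1] is constant there, so its
  derivative vanishes inside.\<close>

lemma hankel_form_Suc_eq_0_imp:
  assumes "hankel_form (Suc r) n c = 0" and "0 < s" "s < 1"
  shows "hankel_form r n (\<lambda>i. c i * s ^ i) = 0"
proof -
  have mono: "hankel_primitive r n c x \<le> hankel_primitive r n c y" if "x \<le> y" for x y
    using that by (rule DERIV_nonneg_imp_nondecreasing)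
      (rule exI, rule conjI[OF DERIV_hankel_primitive hankel_form_nonneg])
  have const: "hankel_primitive r n c x = 0" if "0 \<le> x" "x \<le> 1" for x
    using mono[OF that(1)] mono[OF that(2)] assms(1)
    by (simp add: hankel_primitive_0 hankel_primitive_1)
  show ?thesis
  proof (rule DERIV_local_const[OF DERIV_hankel_primitive])
    \<comment> \<open>This radius keeps the neighbourhood of \<open>s\<close> inside [0,1].\<close>
    show "0 < min s (1 - s)" using assms by simp
    show "\<forall>y. \<bar>s - y\<bar> < min s (1 - s) \<longrightarrow> hankel_primitive r n c s = hankel_primitive r n c y"
      using const assms by auto
  qed
qed

lemma hankel_form_definite:
  assumes "hankel_form (Suc r) n c = 0" and "i \<le> n"
  shows "c i = 0"
  using assms
proof (induction r arbitrary: c)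
  case 0
  \<comment> \<open>H_0 of the scaled vector is the square of a polynomial value at
    \<open>s\<close>; infinitely many roots force all coefficients to vanish.\<close>
  have "{0<..<1::real} \<subseteq> {s. (\<Sum>i\<le>n. c i * s ^ i) = 0}"
    using hankel_form_Suc_eq_0_imp[OF 0(1)] by (auto simp: hankel_form_0)
  moreover have "infinite {0<..<1::real}" by (simp add: infinite_Ioo)
  ultimately have "infinite {s. (\<Sum>i\<le>n. c i * s ^ i) = 0}" by (rule infinite_super)
  then show ?case using 0(2) polyfun_finite_roots[of c n] by blast
next
  case (Suc r)
  \<comment> \<open>Any single point of (0,1) would do: the scaling factors are nonzero.\<close>
  have "hankel_form (Suc r) n (\<lambda>i. c i * (1/2) ^ i) = 0"
    by (rule hankel_form_Suc_eq_0_imp[OF Suc.prems(1)]) auto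
  then have "c i * (1/2) ^ i = 0" using Suc.prems(2) by (rule Suc.IH)
  then show ?case by simp
qed

text \<open>Pairing the kernel equations with \<open>c\<close> itself gives H_r(c) = 0, and
  definiteness applies.\<close>

lemma hankel_kernel_trivial:
  fixes c :: "nat \<Rightarrow> real"
  assumes "r \<ge> 1" and ker: "\<And>j. j \<le> n \<Longrightarrow> (\<Sum>i\<le>n. c i / of_nat (i + j + 1) ^ r) = 0"
    and "i \<le> n"
  shows "c i = 0"
proof -
  have "hankel_form r n c = (\<Sum>j\<le>n. \<Sum>i\<le>n. c i * c j / of_nat (i + j + 1) ^ r)"
    unfolding hankel_form_def by (rule sum.swap)
  also have "\<dots> = (\<Sum>j\<le>n. c j * (\<Sum>i\<le>n. c i / of_nat (i + j + 1) ^ r))"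
    by (simp add: sum_distrib_left mult_ac)
  also have "\<dots> = 0" by (rule sum.neutral) (use ker in simp)
  finally show ?thesis using assms hankel_form_definite[of "r - 1" n c i] by simp
qed

lemma poly_in_z_altdef:
  assumes "degree P \<le> n"
  shows "poly_in_z P = (\<Sum>i\<le>n. fls_const (coeff P i) * fls_X_inv ^ i)"
proof -
  have "degree (map_poly fls_const P) \<le> n"
    using assms map_poly_degree_leq order_trans by blast
  then have "poly_in_z P = (\<Sum>i\<le>n. coeff (map_poly fls_const P) i * fls_X_inv ^ i)"
    unfolding poly_in_z_def poly_altdef
    by (intro sum.mono_neutral_left) (auto simp: coeff_eq_0)
  then show ?thesis by (simp add: coeff_map_poly)
qed

lemma poly_in_z_times_nth:
  assumes "degree P \<le> n"
  shows "fls_nth (poly_in_z P * f) k = (\<Sum>i\<le>n. coeff P i * fls_nth f (k + int i))"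
proof -
  have "fls_nth (fls_const a * fls_X_inv ^ i * f) k = a * fls_nth f (k + int i)" for a i
    by (simp only: mult.assoc fls_X_inv_power_times_conv_shift(1)) simp
  then show ?thesis
    by (simp only: poly_in_z_altdef[OF assms] sum_distrib_right fls_nth_sum)
qed

text \<open>Hence \<open>Q\<close> cannot affect the coefficients of z^-1, z^-2, and so on.\<close>

lemma poly_in_z_nth_pos:
  assumes "k > 0"
  shows "fls_nth (poly_in_z P) k = 0"
  using poly_in_z_times_nth[of P "degree P" 1 k] assms by (simp add: sum.neutral)

lemma Li_inv_z_in_inv_z_power_series: "Li_inv_z r \<in> inv_z_power_series"
proof -
  \<comment> \<open>The constant term of \<open>Li r\<close> is 0, so the shift loses
    nothing.\<close>
  have "Li_inv_z r = fls_X * fps_to_fls (fps_shift 1 (Li r))"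
    by (rule fls_eqI) (auto simp: Li_inv_z_def Li_def fls_X_times_conv_shift nat_diff_distrib)
  then show ?thesis by (auto simp: inv_z_power_series_def)
qed

lemma normal_index_Li_inv_z:
  assumes "r \<ge> 1"
  shows "normal_index (Li_inv_z r) n"
  unfolding normal_index_def
proof (intro allI impI)
  fix P Q
  assume "pade_approximant (Li_inv_z r) n P Q"
  then have P: "P \<noteq> 0" "degree P \<le> n"
    and ord: "ord_inf (poly_in_z P * Li_inv_z r - poly_in_z Q) \<ge> Fin (int n + 1)"
    by (auto simp: pade_approximant_def)
  let ?R = "poly_in_z P * Li_inv_z r - poly_in_z Q"
  have R_nth: "fls_nth ?R (int j + 1) = (\<Sum>i\<le>n. coeff P i / of_nat (i + j + 1) ^ r)" for j
  proof -
    have "nat (int j + 1 + int i) = i + j + 1" for i by simp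
    then show ?thesis
      by (simp add: poly_in_z_times_nth[OF P(2)] poly_in_z_nth_pos Li_inv_z_def Li_def)
  qed
  have low: "fls_nth ?R k = 0" if "k < int n + 1" for k
    using ord that fls_eq0_below_subdegree[of k ?R]
    by (cases "?R = 0") (auto simp: ord_inf_def simp del: fls_minus_nth)
  have "fls_nth ?R (int n + 1) \<noteq> 0"
  proof
    assume top: "fls_nth ?R (int n + 1) = 0"
    \<comment> \<open>The order bound yields the rows j < n; \<open>top\<close> supplies the last
      row j = n and makes the system square.\<close>
    have ker: "(\<Sum>i\<le>n. coeff P i / of_nat (i + j + 1) ^ r) = 0" if "j \<le> n" for j
      using low[of "int j + 1"] top that R_nth[of j] by (cases "j = n") auto
    \<comment> \<open>The definiteness argument is analytic, so the equations move to the
      reals.\<close>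
    have "(\<Sum>i\<le>n. real_of_rat (coeff P i) / of_nat (i + j + 1) ^ r) = 0" if "j \<le> n" for j
      using arg_cong[OF ker[OF that], of real_of_rat]
      by (simp add: of_rat_sum of_rat_divide of_rat_power of_rat_add)
    then have "real_of_rat (coeff P (degree P)) = 0"
      using P(2) by (rule hankel_kernel_trivial[OF assms])
    then show False using P(1) by simp
  qed
  then show "ord_inf ?R = Fin (int n + 1)"
    using low by (auto simp: ord_inf_def intro!: fls_subdegree_eqI)
qed

theorem mainTheorem3:
  fixes r :: nat
  assumes "r \<ge> 1"
  shows "Li_inv_z r \<in> inv_z_power_series \<and> perfect (Li_inv_z r)"
  using Li_inv_z_in_inv_z_power_series normal_index_Li_inv_z[OF assms]
  by (simp add: perfect_def)

end
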